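(* Let $J\subset\mathbb{R}_0^d$ be a compact set, and let $\Theta_c'$ be a set of functions $c:\Omega\times J\to J$ such that: (i) there exists $K_2>0$ with $\|c(\mathbf{x},\mathbf{z})-c(\mathbf{y},\mathbf{z})\|_2^2\le K_2\|\mathbf{x}-\mathbf{y}\|_2^2$ for every $\mathbf{z}$, uniformly in $c\in\Theta_c'$; (ii) there exists $K_c>0$, uniform in $c\in\Theta_c'$, with $\|c(\mathbf{x},\mathbf{z})-c(\mathbf{x},\boldsymbol{\xi})\|_2^2\le K_c\|\mathbf{z}-\boldsymbol{\xi}\|_2^2$ for every $\mathbf{x}\in\Omega$; (iii) for every $\mathbf{x}\in\Omega$ there exists a compact set $J_{\mathbf{x}}\subset\mathbb{R}_0^d$ which is the image of $c(\mathbf{x},\cdot)$ simultaneously for every $c\in\Theta_c'$; (iv) $c(\mathbf{x},\cdot)$ is not constant on any open ball for any $\mathbf{x}\in\Omega$ or any $c\in\Theta_c'$. Let $\Pi_c$ be the discrete net prior built from $\Theta_c'$ (defined in the context). Then samples from $\Pi_c$ satisfy conditions (i)–(iv), and with $\Pi_c$-probability $1$ there exists $R_c>0$ such that $\sup_{\mathbf{x}\in\Omega,\mathbf{z}\in J}\{c(\mathbf{x},\mathbf{z})\}=\sup_{\mathbf{x}\in B_0(R_c),\mathbf{z}\in J}\{c(\mathbf{x},\mathbf{z})\}$, and likewise for infima. Moreover, for any $c_0\in\Theta_c'$, any compact set $A\subset\Omega$ and any $\varepsilon>0$, $$\Pi_c\Big(c:\sup_{\mathbf{x}\in A,\,\mathbf{z}\in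 J}\|c(\mathbf{x},\mathbf{z})-c_0(\mathbf{x},\mathbf{z})\|_2<\varepsilon\Big)>0.$$
   Context: $\Omega\subseteq\mathbb{R}^d$ is a domain and $\mathbb{R}_0^d=\mathbb{R}^d\setminus\{\mathbf{0}\}$. $B_0(m)\subset\Omega$ denotes the closed ball of radius $m$ centred at the origin and $P_m$ the orthogonal projection onto $B_0(m)$. Suprema and infima of vector-valued functions are understood coordinatewise. **Discrete net prior.** For $m\in\mathbb{N}$ let $\Theta_c^{(m)}:=\{c|_{B_0(m)}:c\in\Theta_c'\}$ be the set of restrictions of the first argument to $B_0(m)$; it is totally bounded in the uniform norm. Let $\{\varepsilon_n\}_{n\in\mathbb{N}}$ be strictly positive numbers tending to $0$. For each $m,n$ let $\Theta_c^{(m,n)}$ be a finite $\varepsilon_n$-net over $\Theta_c^{(m)}$ consisting of elements of $\Theta_c^{(m)}$: a finite set such that every element of $\Theta_c^{(m)}$ is within distance $\varepsilon_n$, in the supremum norm, of some element of $\Theta_c^{(m,n)}$. Each element of $\Theta_c^{(m,n)}$ is extended to $\Omega\times J$ by $c(\mathbf{x},\mathbf{z})=c(P_m\mathbf{x},\mathbf{z})$ for $\mathbf{x}$ outside $B_0(m)$. Fix strictly positive probability mass functions $\{p_m\}_{m\in\mathbb{N}}$ and $\{q_n\}_{n\in\mathbb{N}}$. A draw $c\sim\Pi_c$ is obtained by sampling $m\sim p$ and $n\sim q$ independently, and then $c$ uniformly from the finite set $\Theta_c^{(m,n)}$ (extended to $\Omega\times J$ by setting $c(\mathbf{x},\mathbf{z})=c(P_m\mathbf{x},\mathbf{z})$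 for $\mathbf{x}$ outside $B_0(m)$).
   Formalization: For samples, condition (iii) is stated for each draw, and with a common J_x for all draws having the same m; a single J_x common to all draws fails in general, because a draw at level m has image J_{P_m x} at x, which may depend on m. *)

theory Defs
  imports "HOL-Probability.Probability"
begin

text \<open>
  A function from \<open>\<Omega> \<times> J\<close> to \<open>J\<close> is an element of \<open>\<Omega> \<times> J \<rightarrow>\<^sub>E J\<close>, i.e. it takes the value
  \<open>undefined\<close> off its domain, so that equality in HOL is equality of functions on the domain.

  The four conditions are conditions on a class of coefficients: the constants, and
  the image set in \<open>common_image\<close>, do not depend on the member of the class.
\<close>

type_synonym 'n coeff = "(real ^ 'n) \<times> (real ^ 'n) \<Rightarrow> real ^ 'n"

definition lipschitz_state ::
    "(real ^ 'n) set \<Rightarrow> (real ^ 'n) set \<Rightarrow> 'n::finite coeff set \<Rightarrow> bool" where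
  "lipschitz_state \<Omega> J \<Theta> \<longleftrightarrow>
     (\<exists>K>0. \<forall>c\<in>\<Theta>. \<forall>z\<in>J. \<forall>x\<in>\<Omega>. \<forall>y\<in>\<Omega>.
        (norm (c (x, z) - c (y, z)))\<^sup>2 \<le> K * (norm (x - y))\<^sup>2)"

definition lipschitz_jump ::
    "(real ^ 'n) set \<Rightarrow> (real ^ 'n) set \<Rightarrow> 'n::finite coeff set \<Rightarrow> bool" where
  "lipschitz_jump \<Omega> J \<Theta> \<longleftrightarrow>
     (\<exists>K>0. \<forall>c\<in>\<Theta>. \<forall>x\<in>\<Omega>. \<forall>z\<in>J. \<forall>\<xi>\<in>J.
        (norm (c (x, z) - c (x, \<xi>)))\<^sup>2 \<le> K * (norm (z - \<xi>))\<^sup>2)"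

definition common_image ::
    "(real ^ 'n) set \<Rightarrow> (real ^ 'n) set \<Rightarrow> 'n::finite coeff set \<Rightarrow> bool" where
  "common_image \<Omega> J \<Theta> \<longleftrightarrow>
     (\<forall>x\<in>\<Omega>. \<exists>Jx. compact Jx \<and> 0 \<notin> Jx \<and> (\<forall>c\<in>\<Theta>. (\<lambda>z. c (x, z)) ` J = Jx))"

text \<open>\<open>c (x, \<cdot>)\<close> is only defined on \<open>J\<close>, so the open balls at issue are those inside \<open>J\<close>.\<close>

definition nowhere_constant ::
    "(real ^ 'n) set \<Rightarrow> (real ^ 'n) set \<Rightarrow> 'n::finite coeff set \<Rightarrow> bool" where
  "nowhere_constant \<Omega> J \<Theta> \<longleftrightarrow>
     (\<forall>c\<in>\<Theta>. \<forall>x\<in>\<Omega>. \<forall>a. \<forall>r>0. ball a r \<subseteq> J \<longrightarrow> \<not> (\<lambda>z. c (x, z)) constant_on ball a r)"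

text \<open>
  The uniform distance over \<open>S\<close>, with values in \<open>[0, \<infinity>]\<close>, so that the supremum over the empty
  set is \<open>0\<close>.
\<close>

definition sup_dist :: "'a set \<Rightarrow> ('a \<Rightarrow> 'b::real_normed_vector) \<Rightarrow> ('a \<Rightarrow> 'b) \<Rightarrow> ennreal" where
  "sup_dist S f g = (SUP s\<in>S. ennreal (norm (f s - g s)))"

definition is_finite_net ::
    "'a set \<Rightarrow> real \<Rightarrow> ('a \<Rightarrow> 'b::real_normed_vector) set \<Rightarrow> ('a \<Rightarrow> 'b) set \<Rightarrow> bool" where
  "is_finite_net S e F N \<longleftrightarrow>
     finite N \<and> N \<subseteq> F \<and> (\<forall>f\<in>F. \<exists>g\<in>N. sup_dist S f g \<le> ennreal e)"

definition restrict_class ::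
    "(real ^ 'n) set \<Rightarrow> 'n::finite coeff set \<Rightarrow> nat \<Rightarrow> 'n coeff set" where
  "restrict_class J \<Theta> m = (\<lambda>c. restrict c (cball 0 (real m) \<times> J)) ` \<Theta>"

definition extend_coeff ::
    "(real ^ 'n) set \<Rightarrow> (real ^ 'n) set \<Rightarrow> nat \<Rightarrow> 'n::finite coeff \<Rightarrow> 'n coeff" where
  "extend_coeff \<Omega> J m c =
     (\<lambda>(x, z)\<in>\<Omega> \<times> J.
        if x \<in> cball 0 (real m) then c (x, z)
        else c (closest_point (cball 0 (real m)) x, z))"

definition net_prior ::
    "(real ^ 'n) set \<Rightarrow> (real ^ 'n) set \<Rightarrow> (nat \<Rightarrow> nat \<Rightarrow> 'n::finite coeff set) \<Rightarrow>
     nat pmf \<Rightarrow> nat pmf \<Rightarrow> 'n coeff pmf" where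
  "net_prior \<Omega> J N p q =
     bind_pmf (pair_pmf p q) (\<lambda>(m, n). map_pmf (extend_coeff \<Omega> J m) (pmf_of_set (N m n)))"

end

theory Submission
  imports Defs
begin

text \<open>
  A draw with index \<open>m\<close> is an element of the net over the class restricted to the ball of radius
  \<open>m\<close>, extended by projecting the state onto that ball. Since the net consists of restrictions
  of members of the class, the draw is \<open>(x, z) \<mapsto> c\<^sub>0 (P\<^sub>m x, z)\<close> for an honest member \<open>c\<^sub>0\<close>
  (\<open>set_net_prior_subset\<close>), and everything except the support statement follows from this form
  alone. The projection \<open>P\<^sub>m\<close> maps into \<open>\<Omega>\<close>, so each condition on the jump variable at a fixed
  state \<open>x\<close> is the same condition on \<open>c\<^sub>0\<close> at the state \<open>P\<^sub>m x\<close>, and \<open>P\<^sub>m\<close> is \<open>1\<close>-Lipschitz, so the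
  Lipschitz bound in the state keeps its constant. As \<open>P\<^sub>m\<close> is a retraction onto the ball, the
  draw takes on \<open>\<Omega> \<times> J\<close> exactly the values that it takes on the ball times \<open>J\<close>
  (\<open>truncate_coeff_image\<close>); suprema and infima over the two sets agree because they are suprema
  and infima of one and the same set of values.

  For the support statement, a compact set lies in a ball of some integer radius \<open>m\<close>, on which
  \<open>P\<^sub>m\<close> is the identity. For \<open>n\<close> large the net with index \<open>(m, n)\<close> has an element that is
  \<open>e\<close>-close to \<open>c\<^sub>0\<close> there, and the prior, being discrete, charges every element of every net.
\<close>

section \<open>Truncated coefficients\<close>

definition truncate_coeff ::
    "(real ^ 'n) set \<Rightarrow> (real ^ 'n) set \<Rightarrow> nat \<Rightarrow> 'n::finite coeff \<Rightarrow> 'n coeff" where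
  "truncate_coeff \<Omega> J m c =
     (\<lambda>(x, z)\<in>\<Omega> \<times> J. c (closest_point (cball 0 (real m)) x, z))"

lemma truncate_coeff_apply:
  "x \<in> \<Omega> \<Longrightarrow> z \<in> J \<Longrightarrow>
     truncate_coeff \<Omega> J m c (x, z) = c (closest_point (cball 0 (real m)) x, z)"
  by (simp add: truncate_coeff_def)

lemma closest_point_cball_in [simp]:
  "closest_point (cball 0 (real m)) x \<in> cball (0 :: real ^ 'n::finite) (real m)"
  by (rule closest_point_in_set) auto

text \<open>
  The two branches in the extension coincide because the projection fixes the ball, and the
  restriction is invisible because the projection never leaves it.
\<close>

lemma extend_coeff_restrict:
  fixes c :: "'n::finite coeff"
  shows "extend_coeff \<Omega> J m (restrict c (cball 0 (real m) \<times> J)) = truncate_coeff \<Omega> J m c"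
proof
  fix w :: "(real ^ 'n) \<times> (real ^ 'n)"
  obtain x z where w: "w = (x, z)"
    by fastforce
  have "closest_point (cball 0 (real m)) x = x" if "x \<in> cball 0 (real m)"
    using that by (rule closest_point_self)
  then show "extend_coeff \<Omega> J m (restrict c (cball 0 (real m) \<times> J)) w = truncate_coeff \<Omega> J m c w"
    using closest_point_cball_in[of m x]
    by (auto simp: w extend_coeff_def truncate_coeff_def restrict_def)
qed

lemma truncate_coeff_PiE:
  assumes "c \<in> \<Omega> \<times> J \<rightarrow>\<^sub>E J" and "cball 0 (real m) \<subseteq> \<Omega>"
  shows "truncate_coeff \<Omega> J m c \<in> \<Omega> \<times> J \<rightarrow>\<^sub>E J"
  unfolding truncate_coeff_def
proof (rule restrict_PiE_iff[THEN iffD2], clarify)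
  fix x z
  assume "x \<in> \<Omega>" "z \<in> J"
  moreover have "closest_point (cball 0 (real m)) x \<in> \<Omega>"
    using assms(2) closest_point_cball_in[of m x] by blast
  ultimately show "c (closest_point (cball 0 (real m)) x, z) \<in> J"
    by (intro PiE_mem[OF assms(1)]) simp
qed

lemma truncate_coeff_image:
  assumes "cball 0 (real m) \<subseteq> \<Omega>"
  shows "truncate_coeff \<Omega> J m c ` (\<Omega> \<times> J) = truncate_coeff \<Omega> J m c ` (cball 0 (real m) \<times> J)"
proof
  show "truncate_coeff \<Omega> J m c ` (\<Omega> \<times> J) \<subseteq> truncate_coeff \<Omega> J m c ` (cball 0 (real m) \<times> J)"
  proof (clarsimp simp del: mem_cball)
    fix x z
    assume "x \<in> \<Omega>" "z \<in> J"
    let ?y = "closest_point (cball 0 (real m)) x"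
    have y: "?y \<in> cball 0 (real m)"
      by (rule closest_point_cball_in)
    then have "truncate_coeff \<Omega> J m c (x, z) = truncate_coeff \<Omega> J m c (?y, z)"
      using \<open>x \<in> \<Omega>\<close> \<open>z \<in> J\<close> assms by (simp add: truncate_coeff_apply closest_point_self subset_iff)
    then show "truncate_coeff \<Omega> J m c (x, z) \<in> truncate_coeff \<Omega> J m c ` (cball 0 (real m) \<times> J)"
      using y \<open>z \<in> J\<close> by blast
  qed
qed (use assms in blast)

section \<open>The four conditions pass to truncations\<close>

text \<open>
  In the two Lipschitz conditions and in the non-constancy condition the radius may vary within
  the class, since the constants do not depend on it.
\<close>

lemma lipschitz_state_truncate:
  fixes \<Theta> :: "'n::finite coeff set"
  assumes lip: "lipschitz_state \<Omega> J \<Theta>"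
    and balls: "\<And>m. m \<in> M \<Longrightarrow> cball 0 (real m) \<subseteq> \<Omega>"
    and T: "T \<subseteq> (\<Union>m\<in>M. truncate_coeff \<Omega> J m ` \<Theta>)"
  shows "lipschitz_state \<Omega> J T"
proof -
  obtain K where K: "K > 0" and bound: "\<And>c z x y. c \<in> \<Theta> \<Longrightarrow> z \<in> J \<Longrightarrow> x \<in> \<Omega> \<Longrightarrow> y \<in> \<Omega> \<Longrightarrow>
      (norm (c (x, z) - c (y, z)))\<^sup>2 \<le> K * (norm (x - y))\<^sup>2"
    using lip unfolding lipschitz_state_def by blast
  have "(norm (c (x, z) - c (y, z)))\<^sup>2 \<le> K * (norm (x - y))\<^sup>2"
    if c: "c \<in> T" and z: "z \<in> J" and x: "x \<in> \<Omega>" and y: "y \<in> \<Omega>" for c z x y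
  proof -
    obtain m c0 where m: "m \<in> M" and c0: "c0 \<in> \<Theta>" and c_eq: "c = truncate_coeff \<Omega> J m c0"
      using T c by blast
    let ?P = "closest_point (cball 0 (real m)) :: real ^ 'n \<Rightarrow> _"
    have P: "?P u \<in> \<Omega>" for u
      using balls[OF m] closest_point_cball_in[of m u] by blast
    have "dist (?P x) (?P y) \<le> dist x y"
      by (rule closest_point_lipschitz) auto
    then have "(norm (?P x - ?P y))\<^sup>2 \<le> (norm (x - y))\<^sup>2"
      unfolding dist_norm by (rule power_mono) simp
    then have "K * (norm (?P x - ?P y))\<^sup>2 \<le> K * (norm (x - y))\<^sup>2"
      using K by simp
    then show ?thesis
      using bound[OF c0 z P P, of x y] x y z by (simp add: c_eq truncate_coeff_apply)
  qed
  with K show ?thesis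
    unfolding lipschitz_state_def by blast
qed

lemma lipschitz_jump_truncate:
  assumes lip: "lipschitz_jump \<Omega> J \<Theta>"
    and balls: "\<And>m. m \<in> M \<Longrightarrow> cball 0 (real m) \<subseteq> \<Omega>"
    and T: "T \<subseteq> (\<Union>m\<in>M. truncate_coeff \<Omega> J m ` \<Theta>)"
  shows "lipschitz_jump \<Omega> J T"
proof -
  obtain K where K: "K > 0" and bound: "\<And>c x z \<xi>. c \<in> \<Theta> \<Longrightarrow> x \<in> \<Omega> \<Longrightarrow> z \<in> J \<Longrightarrow> \<xi> \<in> J \<Longrightarrow>
      (norm (c (x, z) - c (x, \<xi>)))\<^sup>2 \<le> K * (norm (z - \<xi>))\<^sup>2"
    using lip unfolding lipschitz_jump_def by blast
  have "(norm (c (x, z) - c (x, \<xi>)))\<^sup>2 \<le> K * (norm (z - \<xi>))\<^sup>2"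
    if c: "c \<in> T" and x: "x \<in> \<Omega>" and z: "z \<in> J" and \<xi>: "\<xi> \<in> J" for c x z \<xi>
  proof -
    obtain m c0 where m: "m \<in> M" and c0: "c0 \<in> \<Theta>" and c_eq: "c = truncate_coeff \<Omega> J m c0"
      using T c by blast
    have "closest_point (cball 0 (real m)) x \<in> \<Omega>"
      using balls[OF m] closest_point_cball_in[of m x] by blast
    from bound[OF c0 this z \<xi>] show ?thesis
      using x z \<xi> by (simp add: c_eq truncate_coeff_apply)
  qed
  with K show ?thesis
    unfolding lipschitz_jump_def by blast
qed

text \<open>
  Here the radius has to be fixed: the image at \<open>x\<close> is the image of the class at the projection
  of \<open>x\<close>, which moves with the radius.
\<close>

lemma common_image_truncate:
  assumes img: "common_image \<Omega> J \<Theta>"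
    and ball: "cball 0 (real m) \<subseteq> \<Omega>"
    and T: "T \<subseteq> truncate_coeff \<Omega> J m ` \<Theta>"
  shows "common_image \<Omega> J T"
  unfolding common_image_def
proof
  fix x
  assume x: "x \<in> \<Omega>"
  have "closest_point (cball 0 (real m)) x \<in> \<Omega>"
    using ball closest_point_cball_in[of m x] by blast
  then obtain Jx where Jx: "compact Jx" "0 \<notin> Jx"
    and "\<forall>c\<in>\<Theta>. (\<lambda>z. c (closest_point (cball 0 (real m)) x, z)) ` J = Jx"
    using img unfolding common_image_def by blast
  moreover have "(\<lambda>z. truncate_coeff \<Omega> J m c (x, z)) ` J =
      (\<lambda>z. c (closest_point (cball 0 (real m)) x, z)) ` J" for c
    using x by (intro image_cong) (auto simp: truncate_coeff_apply)
  ultimately have "(\<lambda>z. truncate_coeff \<Omega> J m c (x, z)) ` J = Jx" if "c \<in> \<Theta>" for c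
    using that by simp
  then have "\<forall>c\<in>T. (\<lambda>z. c (x, z)) ` J = Jx"
    using T by blast
  with Jx show "\<exists>Jx. compact Jx \<and> 0 \<notin> Jx \<and> (\<forall>c\<in>T. (\<lambda>z. c (x, z)) ` J = Jx)"
    by blast
qed

lemma nowhere_constant_truncate:
  assumes nc: "nowhere_constant \<Omega> J \<Theta>"
    and balls: "\<And>m. m \<in> M \<Longrightarrow> cball 0 (real m) \<subseteq> \<Omega>"
    and T: "T \<subseteq> (\<Union>m\<in>M. truncate_coeff \<Omega> J m ` \<Theta>)"
  shows "nowhere_constant \<Omega> J T"
  unfolding nowhere_constant_def
proof (intro ballI allI impI)
  fix c x a and r :: real
  assume c: "c \<in> T" and x: "x \<in> \<Omega>" and r: "r > 0" and sub: "ball a r \<subseteq> J"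
  obtain m c0 where m: "m \<in> M" and c0: "c0 \<in> \<Theta>" and c_eq: "c = truncate_coeff \<Omega> J m c0"
    using T c by blast
  have "closest_point (cball 0 (real m)) x \<in> \<Omega>"
    using balls[OF m] closest_point_cball_in[of m x] by blast
  then have "\<not> (\<lambda>z. c0 (closest_point (cball 0 (real m)) x, z)) constant_on ball a r"
    using nc c0 r sub unfolding nowhere_constant_def by blast
  moreover have "c (x, z) = c0 (closest_point (cball 0 (real m)) x, z)" if "z \<in> ball a r" for z
    using that sub x by (simp add: c_eq truncate_coeff_apply subset_iff)
  ultimately show "\<not> (\<lambda>z. c (x, z)) constant_on ball a r"
    by (simp add: constant_on_def)
qed

section \<open>The support of the prior\<close>

lemma set_net_prior:
  assumes "set_pmf p = {1..}" "set_pmf q = {1..}"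
    and "\<And>m n. m \<ge> 1 \<Longrightarrow> n \<ge> 1 \<Longrightarrow> finite (N m n) \<and> N m n \<noteq> {}"
  shows "set_pmf (net_prior \<Omega> J N p q) = (\<Union>m\<in>{1..}. \<Union>n\<in>{1..}. extend_coeff \<Omega> J m ` N m n)"
  using assms by (fastforce simp: net_prior_def)

lemma finite_net_nonempty:
  "is_finite_net S e F N \<Longrightarrow> F \<noteq> {} \<Longrightarrow> N \<noteq> {}"
  unfolding is_finite_net_def by blast

lemma extend_net_subset:
  assumes "is_finite_net S e (restrict_class J \<Theta> m) N"
  shows "extend_coeff \<Omega> J m ` N \<subseteq> truncate_coeff \<Omega> J m ` \<Theta>"
  using assms by (auto simp: is_finite_net_def restrict_class_def extend_coeff_restrict)

text \<open>
  On a subset of the ball the extension changes nothing, so a net element that approximates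
  \<open>c\<^sub>0\<close> on the ball does so, once extended, on the subset.
\<close>

lemma extend_net_approximates:
  assumes net: "is_finite_net (cball 0 (real m) \<times> J) e (restrict_class J \<Theta> m) N"
    and c0: "c0 \<in> \<Theta>" and A: "A \<subseteq> cball 0 (real m)" "A \<subseteq> \<Omega>"
  obtains g where "g \<in> N" "sup_dist (A \<times> J) (extend_coeff \<Omega> J m g) c0 \<le> ennreal e"
proof -
  let ?r = "restrict c0 (cball 0 (real m) \<times> J)"
  have "?r \<in> restrict_class J \<Theta> m"
    using c0 by (auto simp: restrict_class_def)
  then obtain g where g: "g \<in> N" and d: "sup_dist (cball 0 (real m) \<times> J) ?r g \<le> ennreal e"
    using net unfolding is_finite_net_def by blast
  have "sup_dist (A \<times> J) (extend_coeff \<Omega> J m g) c0 \<le> sup_dist (cball 0 (real m) \<times> J) ?r g"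
    unfolding sup_dist_def
  proof (rule SUP_mono)
    fix w
    assume w: "w \<in> A \<times> J"
    then have "extend_coeff \<Omega> J m g w = g w" "?r w = c0 w"
      using A by (auto simp: extend_coeff_def)
    then show "\<exists>v\<in>cball 0 (real m) \<times> J.
        ennreal (norm (extend_coeff \<Omega> J m g w - c0 w)) \<le> ennreal (norm (?r v - g v))"
      using w A by (intro bexI[of _ w]) (auto simp: norm_minus_commute)
  qed
  with g d show thesis
    by (intro that) (auto intro: order_trans)
qed

lemma set_net_prior_subset:
  assumes "set_pmf p = {1..}" "set_pmf q = {1..}"
    and "\<And>m n. m \<ge> 1 \<Longrightarrow> n \<ge> 1 \<Longrightarrow>
        is_finite_net (S m n) (\<epsilon> n) (restrict_class J \<Theta> m) (N m n)"
    and "\<Theta> \<noteq> {}"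
  shows "set_pmf (net_prior \<Omega> J N p q) \<subseteq> (\<Union>m\<in>{1..}. truncate_coeff \<Omega> J m ` \<Theta>)"
proof -
  have "finite (N m n) \<and> N m n \<noteq> {}" if "m \<ge> 1" "n \<ge> 1" for m n
    using assms(3)[OF that] assms(4) finite_net_nonempty
    by (fastforce simp: is_finite_net_def restrict_class_def)
  then have "set_pmf (net_prior \<Omega> J N p q) = (\<Union>m\<in>{1..}. \<Union>n\<in>{1..}. extend_coeff \<Omega> J m ` N m n)"
    by (rule set_net_prior[OF assms(1,2)])
  also have "\<dots> \<subseteq> (\<Union>m\<in>{1..}. truncate_coeff \<Omega> J m ` \<Theta>)"
    using assms(3) by (intro UN_mono UN_least subset_refl extend_net_subset) auto
  finally show ?thesis .
qed

text \<open>
  A compact set of states fits into a ball of integer radius \<open>m \<ge> 1\<close> and \<open>\<epsilon>\<^sub>n < e\<close> for large \<open>n\<close>;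
  the net with that index supplies a point of positive mass.
\<close>

lemma net_prior_charges_neighbourhood:
  assumes pmfs: "set_pmf p = {1..}" "set_pmf q = {1..}"
    and nets: "\<And>m n. m \<ge> 1 \<Longrightarrow> n \<ge> 1 \<Longrightarrow>
        is_finite_net (cball 0 (real m) \<times> J) (\<epsilon> n) (restrict_class J \<Theta> m) (N m n)"
    and eps: "\<epsilon> \<longlonglongrightarrow> 0"
    and c0: "c0 \<in> \<Theta>" and A: "compact A" "A \<subseteq> \<Omega>" and e: "e > 0"
  shows "measure_pmf.prob (net_prior \<Omega> J N p q) {c. sup_dist (A \<times> J) c c0 < ennreal e} > 0"
proof -
  obtain b where b: "\<And>x. x \<in> A \<Longrightarrow> norm x \<le> b"
    using compact_imp_bounded[OF A(1)] unfolding bounded_iff by blast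
  obtain k where k: "b \<le> real k"
    using real_arch_simple by blast
  define m where "m = Suc k"
  have m: "m \<ge> 1" and Am: "A \<subseteq> cball 0 (real m)"
    using b k by (force simp: m_def)+
  have "\<forall>\<^sub>F n in sequentially. \<epsilon> n < e \<and> 1 \<le> n"
    using order_tendstoD(2)[OF eps e] eventually_ge_at_top by (rule eventually_conj)
  then obtain n where n: "n \<ge> 1" and small: "\<epsilon> n < e"
    using eventually_happens'[OF sequentially_bot] by blast
  obtain g where g: "g \<in> N m n"
    and close: "sup_dist (A \<times> J) (extend_coeff \<Omega> J m g) c0 \<le> ennreal (\<epsilon> n)"
    by (rule extend_net_approximates[OF nets[OF m n] c0 Am A(2)])
  have "finite (N m n) \<and> N m n \<noteq> {}" if "m \<ge> 1" "n \<ge> 1" for m n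
    using nets[OF that] c0 finite_net_nonempty
    by (fastforce simp: is_finite_net_def restrict_class_def)
  then have "extend_coeff \<Omega> J m g \<in> set_pmf (net_prior \<Omega> J N p q)"
    using m n g by (subst set_net_prior[OF pmfs]) auto
  moreover have "sup_dist (A \<times> J) (extend_coeff \<Omega> J m g) c0 < ennreal e"
    using close small e by (meson ennreal_lessI le_less_trans)
  ultimately show ?thesis
    by (intro measure_pmf_posI) auto
qed

section \<open>Properties of the discrete net prior\<close>

(* SUP and INF of (real ^ 'n)-valued functions are the coordinatewise ones of the library.
   The common image of the third condition is common to all draws with the same m; for
   different m the images at x are those of the class at different projections of x. *)
theorem mainTheorem2:
  fixes \<Omega> J :: "(real ^ 'n::finite) set"
    and \<Theta> :: "'n coeff set"
    and \<epsilon> :: "nat \<Rightarrow> real"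
    and N :: "nat \<Rightarrow> nat \<Rightarrow> 'n coeff set"
    and p q :: "nat pmf"
  defines "Pr \<equiv> net_prior \<Omega> J N p q"
  assumes domain: "open \<Omega>" "connected \<Omega>" "\<Omega> \<noteq> {}"
    and balls: "\<And>m. m \<ge> 1 \<Longrightarrow> cball 0 (real m) \<subseteq> \<Omega>"
    and J: "compact J" "0 \<notin> J"
    and \<Theta>: "\<Theta> \<subseteq> \<Omega> \<times> J \<rightarrow>\<^sub>E J" "\<Theta> \<noteq> {}"
    and cond_i: "lipschitz_state \<Omega> J \<Theta>"
    and cond_ii: "lipschitz_jump \<Omega> J \<Theta>"
    and cond_iii: "common_image \<Omega> J \<Theta>"
    and cond_iv: "nowhere_constant \<Omega> J \<Theta>"
    and eps: "\<And>n. n \<ge> 1 \<Longrightarrow> \<epsilon> n > 0" "\<epsilon> \<longlonglongrightarrow> 0"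
    and nets: "\<And>m n. m \<ge> 1 \<Longrightarrow> n \<ge> 1 \<Longrightarrow>
        is_finite_net (cball 0 (real m) \<times> J) (\<epsilon> n) (restrict_class J \<Theta> m) (N m n)"
    and pmfs: "set_pmf p = {1..}" "set_pmf q = {1..}"
  shows "set_pmf Pr \<subseteq> \<Omega> \<times> J \<rightarrow>\<^sub>E J \<and>
      lipschitz_state \<Omega> J (set_pmf Pr) \<and>
      lipschitz_jump \<Omega> J (set_pmf Pr) \<and>
      (\<forall>c\<in>set_pmf Pr. common_image \<Omega> J {c}) \<and>
      (\<forall>m\<ge>1. common_image \<Omega> J (\<Union>n\<in>{1..}. extend_coeff \<Omega> J m ` N m n)) \<and>
      nowhere_constant \<Omega> J (set_pmf Pr) \<and>
      measure_pmf.prob Pr {c. \<exists>R>0. cball 0 R \<subseteq> \<Omega> \<and>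
        (SUP xz\<in>\<Omega> \<times> J. c xz) = (SUP xz\<in>cball 0 R \<times> J. c xz) \<and>
        (INF xz\<in>\<Omega> \<times> J. c xz) = (INF xz\<in>cball 0 R \<times> J. c xz)} = 1 \<and>
      (\<forall>c0\<in>\<Theta>. \<forall>A e. compact A \<longrightarrow> A \<subseteq> \<Omega> \<longrightarrow> e > 0 \<longrightarrow>
        measure_pmf.prob Pr {c. sup_dist (A \<times> J) c c0 < ennreal e} > 0)"
proof -
  have sub: "set_pmf Pr \<subseteq> (\<Union>m\<in>{1..}. truncate_coeff \<Omega> J m ` \<Theta>)"
    unfolding Pr_def using pmfs nets \<Theta>(2) by (rule set_net_prior_subset)
  have ball: "cball 0 (real m) \<subseteq> \<Omega>" if "m \<in> {1..}" for m
    using balls that by simp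
  show ?thesis
  proof (intro conjI ballI allI impI subsetI)
    show "c \<in> \<Omega> \<times> J \<rightarrow>\<^sub>E J" if c: "c \<in> set_pmf Pr" for c
    proof -
      obtain m c0 where m: "m \<in> {1..}" and c0: "c0 \<in> \<Theta>" and c_eq: "c = truncate_coeff \<Omega> J m c0"
        using sub c by blast
      show ?thesis
        unfolding c_eq using \<Theta>(1) c0 ball[OF m] by (intro truncate_coeff_PiE) auto
    qed
    show "lipschitz_state \<Omega> J (set_pmf Pr)"
      using cond_i ball sub by (rule lipschitz_state_truncate)
    show "lipschitz_jump \<Omega> J (set_pmf Pr)"
      using cond_ii ball sub by (rule lipschitz_jump_truncate)
    show "common_image \<Omega> J {c}" if c: "c \<in> set_pmf Pr" for c
    proof -
      obtain m where "m \<in> {1..}" and "c \<in> truncate_coeff \<Omega> J m ` \<Theta>"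
        using sub c by blast
      then show ?thesis
        using common_image_truncate[OF cond_iii ball, of m "{c}"] by blast
    qed
    show "common_image \<Omega> J (\<Union>n\<in>{1..}. extend_coeff \<Omega> J m ` N m n)" if m: "m \<ge> 1" for m
      using m extend_net_subset[OF nets[OF m]]
      by (intro common_image_truncate[OF cond_iii balls[OF m]] UN_least) auto
    show "nowhere_constant \<Omega> J (set_pmf Pr)"
      using cond_iv ball sub by (rule nowhere_constant_truncate)
    show "measure_pmf.prob Pr {c. \<exists>R>0. cball 0 R \<subseteq> \<Omega> \<and>
          (SUP xz\<in>\<Omega> \<times> J. c xz) = (SUP xz\<in>cball 0 R \<times> J. c xz) \<and>
          (INF xz\<in>\<Omega> \<times> J. c xz) = (INF xz\<in>cball 0 R \<times> J. c xz)} = 1"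
    proof -
      have "\<exists>R>0. cball 0 R \<subseteq> \<Omega> \<and>
          (SUP xz\<in>\<Omega> \<times> J. c xz) = (SUP xz\<in>cball 0 R \<times> J. c xz) \<and>
          (INF xz\<in>\<Omega> \<times> J. c xz) = (INF xz\<in>cball 0 R \<times> J. c xz)"
        if c: "c \<in> set_pmf Pr" for c
      proof -
        obtain m c0 where m: "m \<in> {1..}" and c_eq: "c = truncate_coeff \<Omega> J m c0"
          using sub c by blast
        have "c ` (\<Omega> \<times> J) = c ` (cball 0 (real m) \<times> J)"
          unfolding c_eq by (rule truncate_coeff_image[OF ball[OF m]])
        then show ?thesis
          using m ball[OF m] by (intro exI[of _ "real m"]) simp
      qed
      then show ?thesis
        by (intro measure_pmf.prob_eq_1[THEN iffD2]) (auto simp: AE_measure_pmf_iff)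
    qed
    show "measure_pmf.prob Pr {c. sup_dist (A \<times> J) c c0 < ennreal e} > 0"
      if "c0 \<in> \<Theta>" "compact A" "A \<subseteq> \<Omega>" "e > 0" for c0 A e
      unfolding Pr_def using pmfs nets eps(2) that by (rule net_prior_charges_neighbourhood)
  qed
qed

end
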